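(* The set $S_\infty$ is closed under matrix multiplication, and $S_\infty$ is a noncommutative semigroup of countably infinite order with $x\mathbf{0}=\mathbf{0}x=\mathbf{0}$ for every $x\in S_\infty$. For any two nonzero elements $\langle d,k,m\rangle$ and $\langle d',k',m'\rangle$ of $S_\infty$, set $$d''=d+d',\qquad k''=\max(k,k'-d),\qquad m''=\min(m,m'-d).$$ Then $\langle d,k,m\rangle\langle d',k',m'\rangle=\langle d'',k'',m''\rangle$ if $k''\le m''$, and $\langle d,k,m\rangle\langle d',k',m'\rangle=\mathbf{0}$ if $k''>m''$. Moreover, irrespective of whether $k''\le m''$ or not, $1-\min(0,d'')\le k''$.
   Context: An infinite matrix is an array $(x_{ij})_{i,j\in\mathbb{N}}$, $\mathbb{N}=\{1,2,\dots\}$. For integers $d\in\mathbb{Z}$ and $k,m\in\mathbb{N}$ with $1-\min(0,d)\le k\le m$, let $\langle d,k,m\rangle$ denote the infinite matrix with $x_{ij}=1$ if $k\le i\le m$ and $j-i=d$, and $x_{ij}=0$ otherwise (its ones lie on the $d$-th diagonal, $d=0$ being the main diagonal and $d>0$ ($d<0$) diagonals above (below) it, in rows $k$ through $m$, forming an uninterrupted block of $m-k+1$ ones). Let $\mathbf{0}$ be the infinite zero matrix and $S_\infty=\{\mathbf{0}\}\cup\{\langle d,k,m\rangle: d\in\mathbb{Z},\ k,m\in\mathbb{N},\ 1-\min(0,d)\le k\le m\}$, with operation matrix multiplication (well defined since each matrix has finitely many nonzero entries). Distinct admissible triples give distinct matrices. *)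

theory Defs
  imports Complex_Main "HOL-Library.Countable_Set"
begin

text \<open>
  The index set is \<open>{1, 2, \<dots>}\<close>. A matrix is represented by a function on all of \<^typ>\<open>nat\<close>;
  row and column 0 are not part of the matrix, and all matrices below are 0 there, so that
  equality of functions is equality of matrices. The entries lie in an arbitrary nontrivial
  semiring.
\<close>

type_synonym 'a inf_matrix = "nat \<Rightarrow> nat \<Rightarrow> 'a"

definition zero_mat :: "'a::semiring_1 inf_matrix"
  where "zero_mat = (\<lambda>i j. 0)"

text \<open>
  Only the nonzero terms are summed; for matrices with finitely many nonzero entries there are
  finitely many of them.
\<close>

definition mat_mult :: "'a::semiring_1 inf_matrix \<Rightarrow> 'a inf_matrix \<Rightarrow> 'a inf_matrix"
    (infixl \<open>\<odot>\<close> 70)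
  where "X \<odot> Y = (\<lambda>i j. \<Sum>l | 1 \<le> l \<and> X i l * Y l j \<noteq> 0. X i l * Y l j)"

text \<open>
  The bounds \<open>k\<close> and \<open>m\<close> are integers, because \<open>k' - d\<close> and \<open>m' - d\<close> are formed from them;
  admissibility forces \<open>1 \<le> k \<le> m\<close>, so admissible triples have positive \<open>k\<close> and \<open>m\<close>.
\<close>

definition admissible :: "int \<Rightarrow> int \<Rightarrow> int \<Rightarrow> bool"
  where "admissible d k m \<longleftrightarrow> 1 - min 0 d \<le> k \<and> k \<le> m"

definition diag_mat :: "int \<Rightarrow> int \<Rightarrow> int \<Rightarrow> 'a::semiring_1 inf_matrix"
    (\<open>\<langle>_,/ _,/ _\<rangle>\<close>)
  where "\<langle>d, k, m\<rangle> =
    (\<lambda>i j. if 1 \<le> i \<and> 1 \<le> j \<and> k \<le> int i \<and> int i \<le> m \<and> int j - int i = d then 1 else 0)"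

definition S_inf :: "'a::semiring_1 inf_matrix set"
  where "S_inf = {zero_mat} \<union> {\<langle>d, k, m\<rangle> | d k m. admissible d k m}"

definition semigroup_on :: "'b set \<Rightarrow> ('b \<Rightarrow> 'b \<Rightarrow> 'b) \<Rightarrow> bool"
  where "semigroup_on S f \<longleftrightarrow>
    S \<noteq> {} \<and> (\<forall>x\<in>S. \<forall>y\<in>S. f x y \<in> S) \<and>
    (\<forall>x\<in>S. \<forall>y\<in>S. \<forall>z\<in>S. f (f x y) z = f x (f y z))"

end

theory Submission
  imports Defs
begin

text \<open>
  If \<open>k > m\<close> then \<open>\<langle>d, k, m\<rangle>\<close> is the zero matrix. Hence \<open>S_inf\<close> consists of all \<open>\<langle>d, k, m\<rangle>\<close> with
  \<open>1 - min 0 d \<le> k\<close>, whether or not \<open>k \<le> m\<close>, and on these triples a single product formula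
  holds without case distinction. Closure and associativity then reduce to identities for \<open>max\<close>
  and \<open>min\<close> of integers.
\<close>

lemma diag_mat_empty: "m < k \<Longrightarrow> \<langle>d, k, m\<rangle> = zero_mat"
  by (auto simp: diag_mat_def zero_mat_def fun_eq_iff)

lemma S_inf_eq: "S_inf = {\<langle>d, k, m\<rangle> | d k m. 1 - min 0 d \<le> k}"
proof (intro equalityI subsetI)
  fix x :: "'a inf_matrix"
  assume "x \<in> S_inf"
  \<comment> \<open>Any triple with \<open>m < k\<close> and a permitted \<open>k\<close> would
    serve; here \<open>1 - min 0 0 = 1\<close>.\<close>
  moreover have "zero_mat = (\<langle>0, 1, 0\<rangle> :: 'a inf_matrix)"
    by (simp add: diag_mat_empty)
  ultimately show "x \<in> {\<langle>d, k, m\<rangle> | d k m. 1 - min 0 d \<le> k}"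
    unfolding S_inf_def admissible_def by fastforce
next
  fix x :: "'a inf_matrix"
  assume "x \<in> {\<langle>d, k, m\<rangle> | d k m. 1 - min 0 d \<le> k}"
  then obtain d k m where "x = \<langle>d, k, m\<rangle>" "1 - min 0 d \<le> k"
    by blast
  then show "x \<in> S_inf"
    using diag_mat_empty[of m k d] unfolding S_inf_def admissible_def by (cases "k \<le> m") auto
qed

lemma mat_mult_zero_right: "X \<odot> zero_mat = zero_mat"
  and mat_mult_zero_left: "zero_mat \<odot> X = zero_mat"
  by (simp_all add: mat_mult_def zero_mat_def)

lemma lower_bound_mult:
  fixes d d' k k' :: int
  assumes "1 - min 0 d \<le> k" "1 - min 0 d' \<le> k'"
  shows "1 - min 0 (d + d') \<le> max k (k' - d)"
  using assms by linarith

lemma diag_mat_mult: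
  assumes "1 - min 0 d \<le> k" "1 - min 0 d' \<le> k'"
  shows "(\<langle>d, k, m\<rangle> :: 'a::semiring_1 inf_matrix) \<odot> \<langle>d', k', m'\<rangle> =
    \<langle>d + d', max k (k' - d), min m (m' - d)\<rangle>"
proof (intro ext)
  fix i j :: nat
  let ?X = "\<langle>d, k, m\<rangle> :: 'a inf_matrix" and ?Y = "\<langle>d', k', m'\<rangle> :: 'a inf_matrix"
  let ?P = "1 \<le> i \<and> 1 \<le> j \<and> max k (k' - d) \<le> int i \<and> int i \<le> min m (m' - d)
    \<and> int j - int i = d + d'"
  \<comment> \<open>As \<open>k\<close> is at least \<open>1 - d\<close>, every row \<open>i\<close>
    from \<open>k\<close> on has \<open>i + d\<close> positive, so \<open>nat\<close> loses nothing
    and the middle index is legal.\<close>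
  have nz: "{l. 1 \<le> l \<and> ?X i l * ?Y l j \<noteq> 0} = (if ?P then {nat (int i + d)} else {})"
    using assms by (auto simp: diag_mat_def split: if_splits)
  have "?X i (nat (int i + d)) * ?Y (nat (int i + d)) j = 1" if ?P
    using that assms by (auto simp: diag_mat_def)
  then have "(?X \<odot> ?Y) i j = (if ?P then 1 else 0)"
    unfolding mat_mult_def nz by auto
  then show "(?X \<odot> ?Y) i j = \<langle>d + d', max k (k' - d), min m (m' - d)\<rangle> i j"
    by (simp add: diag_mat_def)
qed

lemma S_inf_closed:
  assumes "x \<in> S_inf" "y \<in> S_inf"
  shows "x \<odot> y \<in> S_inf"
  using assms lower_bound_mult unfolding S_inf_eq by (fastforce simp: diag_mat_mult)

lemma S_inf_assoc:
  assumes "x \<in> S_inf" "y \<in> S_inf" "z \<in> S_inf"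
  shows "x \<odot> y \<odot> z = x \<odot> (y \<odot> z)"
proof -
  obtain a k m where x: "x = \<langle>a, k, m\<rangle>" "1 - min 0 a \<le> k"
    using assms(1) unfolding S_inf_eq by blast
  obtain b l n where y: "y = \<langle>b, l, n\<rangle>" "1 - min 0 b \<le> l"
    using assms(2) unfolding S_inf_eq by blast
  obtain c p q where z: "z = \<langle>c, p, q\<rangle>" "1 - min 0 c \<le> p"
    using assms(3) unfolding S_inf_eq by blast
  \<comment> \<open>Subtracting \<open>a\<close> commutes with \<open>max\<close> and
    \<open>min\<close>.\<close>
  have "max (max k (l - a)) (p - (a + b)) = max k (max l (p - b) - a)"
    "min (min m (n - a)) (q - (a + b)) = min m (min n (q - b) - a)"
    by linarith+
  moreover have "x \<odot> y \<odot> z =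
      \<langle>a + b + c, max (max k (l - a)) (p - (a + b)), min (min m (n - a)) (q - (a + b))\<rangle>"
    unfolding x(1) y(1) z(1) diag_mat_mult[OF x(2) y(2)]
    \<comment> \<open>The product formula applies a second time because the inner product satisfies
      the lower bound, even if it is zero.\<close>
    by (rule diag_mat_mult[OF lower_bound_mult[OF x(2) y(2)] z(2)])
  moreover have "x \<odot> (y \<odot> z) =
      \<langle>a + (b + c), max k (max l (p - b) - a), min m (min n (q - b) - a)\<rangle>"
    unfolding x(1) y(1) z(1) diag_mat_mult[OF y(2) z(2)]
    by (rule diag_mat_mult[OF x(2) lower_bound_mult[OF y(2) z(2)]])
  ultimately show ?thesis
    by (simp add: add.assoc)
qed

lemma S_inf_noncommutative:
  "\<exists>x \<in> (S_inf :: 'a::semiring_1 inf_matrix set). \<exists>y \<in> S_inf. x \<odot> y \<noteq> y \<odot> x"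
proof (intro bexI)
  \<comment> \<open>These are the matrix units E11 and E12: E11 E12 = E12, but E12 E11 = 0. Entry
    (1,2) separates the products.\<close>
  let ?x = "\<langle>0, 1, 1\<rangle> :: 'a inf_matrix" and ?y = "\<langle>1, 1, 1\<rangle> :: 'a inf_matrix"
  have "?x \<odot> ?y = \<langle>1, 1, 1\<rangle>" "?y \<odot> ?x = \<langle>1, 1, 0\<rangle>"
    by (simp_all add: diag_mat_mult)
  moreover have "(\<langle>1, 1, 1\<rangle> :: 'a inf_matrix) 1 2 \<noteq> \<langle>1, 1, 0\<rangle> 1 2"
    by (simp add: diag_mat_def)
  ultimately show "?x \<odot> ?y \<noteq> ?y \<odot> ?x"
    by metis
  show "?x \<in> S_inf" "?y \<in> S_inf"
    by (force simp: S_inf_def admissible_def)+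
qed

lemma countable_S_inf: "countable S_inf"
proof -
  \<comment> \<open>Triples of integers form a countable type.\<close>
  have "S_inf \<subseteq> range (\<lambda>(d, k, m). \<langle>d, k, m\<rangle>)"
    unfolding S_inf_eq image_def by fastforce
  then show ?thesis
    using countable_subset by blast
qed

lemma infinite_S_inf: "infinite (S_inf :: 'a::semiring_1 inf_matrix set)"
proof -
  have "inj (\<lambda>n. \<langle>int n, 1, 1\<rangle> :: 'a inf_matrix)"
  proof (rule injI)
    fix n p :: nat
    assume "(\<langle>int n, 1, 1\<rangle> :: 'a inf_matrix) = \<langle>int p, 1, 1\<rangle>"
    \<comment> \<open>The only one of \<open>\<langle>int n, 1, 1\<rangle>\<close> is in row 1,
      column \<open>n + 1\<close>, so this entry determines \<open>n\<close>.\<close>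
    then have "(\<langle>int n, 1, 1\<rangle> :: 'a inf_matrix) 1 (Suc n) = \<langle>int p, 1, 1\<rangle> 1 (Suc n)"
      by simp
    then show "n = p"
      by (simp add: diag_mat_def split: if_splits)
  qed
  moreover have "range (\<lambda>n. \<langle>int n, 1, 1\<rangle> :: 'a inf_matrix) \<subseteq> S_inf"
    by (force simp: S_inf_eq)
  ultimately show ?thesis
    using infinite_super range_inj_infinite by blast
qed

theorem theorem1:
  shows "(\<forall>x \<in> (S_inf :: 'a::semiring_1 inf_matrix set). \<forall>y \<in> S_inf. x \<odot> y \<in> S_inf) \<and>
    semigroup_on (S_inf :: 'a inf_matrix set) (\<odot>) \<and>
    (\<exists>x \<in> (S_inf :: 'a inf_matrix set). \<exists>y \<in> S_inf. x \<odot> y \<noteq> y \<odot> x) \<and>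
    countable (S_inf :: 'a inf_matrix set) \<and> infinite (S_inf :: 'a inf_matrix set) \<and>
    (\<forall>x \<in> (S_inf :: 'a inf_matrix set). x \<odot> zero_mat = zero_mat \<and> zero_mat \<odot> x = zero_mat) \<and>
    (\<forall>d k m d' k' m'. admissible d k m \<longrightarrow> admissible d' k' m' \<longrightarrow>
      (let d'' = d + d'; k'' = max k (k' - d); m'' = min m (m' - d) in
        (k'' \<le> m'' \<longrightarrow> (\<langle>d, k, m\<rangle> :: 'a inf_matrix) \<odot> \<langle>d', k', m'\<rangle> = \<langle>d'', k'', m''\<rangle>) \<and>
        (k'' > m'' \<longrightarrow> (\<langle>d, k, m\<rangle> :: 'a inf_matrix) \<odot> \<langle>d', k', m'\<rangle> = zero_mat) \<and>
        1 - min 0 d'' \<le> k''))"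
proof (intro conjI)
  show closed: "\<forall>x \<in> (S_inf :: 'a inf_matrix set). \<forall>y \<in> S_inf. x \<odot> y \<in> S_inf"
    using S_inf_closed by blast
  show "semigroup_on (S_inf :: 'a inf_matrix set) (\<odot>)"
    \<comment> \<open>Nonemptiness comes from infinitude.\<close>
    using closed S_inf_assoc infinite_S_inf unfolding semigroup_on_def by (metis finite.emptyI)
  show "\<forall>x \<in> (S_inf :: 'a inf_matrix set). x \<odot> zero_mat = zero_mat \<and> zero_mat \<odot> x = zero_mat"
    by (simp add: mat_mult_zero_left mat_mult_zero_right)
  show "\<forall>d k m d' k' m'. admissible d k m \<longrightarrow> admissible d' k' m' \<longrightarrow>
      (let d'' = d + d'; k'' = max k (k' - d); m'' = min m (m' - d) in
        (k'' \<le> m'' \<longrightarrow> (\<langle>d, k, m\<rangle> :: 'a inf_matrix) \<odot> \<langle>d', k', m'\<rangle> = \<langle>d'', k'', m''\<rangle>) \<and>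
        (k'' > m'' \<longrightarrow> (\<langle>d, k, m\<rangle> :: 'a inf_matrix) \<odot> \<langle>d', k', m'\<rangle> = zero_mat) \<and>
        1 - min 0 d'' \<le> k'')"
    unfolding Let_def admissible_def
    by (metis diag_mat_mult diag_mat_empty lower_bound_mult)
qed (rule S_inf_noncommutative countable_S_inf infinite_S_inf)+

end
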